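(* Consider any matrix sketching algorithm with inputs $\mathbf X\in\mathbb R^{n\times d_x}$ and $\mathbf Y\in\mathbb R^{n\times d_y}$ and outputs $\mathbf A\in\mathbb R^{m\times d_x}$ and $\mathbf B\in\mathbb R^{m\times d_y}$ with the guarantee $$\|\mathbf X^\top\mathbf Y-\mathbf A^\top\mathbf B\|_2\le\frac1{m-k}\Big(\|\mathbf X\|_F\|\mathbf Y\|_F-\|\mathbf X^\top\mathbf Y\|_k\Big)$$ for any $k<m$. Assuming that a constant number of bits is required to describe a word (i.e., a unit of memory), the algorithm requires at least $\Omega(m(d_x+d_y))$ bits of space.
   Context: For a real matrix $\mathbf M$, $\sigma_1(\mathbf M)\ge\sigma_2(\mathbf M)\ge\cdots$ are its singular values (with $\sigma_i(\mathbf M)=0$ for $i>\operatorname{rank}\mathbf M$), $\|\mathbf M\|_2=\sigma_1(\mathbf M)$ is the spectral norm, $\|\mathbf M\|_F$ the Frobenius norm, and $\|\mathbf M\|_k=\sum_{i=1}^k\sigma_i(\mathbf M)$ the Ky Fan $k$-norm (zero for $k=0$); $k$ ranges over nonnegative integers. A matrix sketching algorithm takes a pair $(\mathbf X,\mathbf Y)$ and outputs a pair $(\mathbf A,\mathbf B)$ such that $\mathbf A^\top\mathbf B$ approximates $\mathbf X^\top\mathbf Y$; the sketch size $m$ is assumed to be much smaller than $n$, $d_x$ and $d_y$.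
   Formalization: The sketch size is assumed to satisfy m ≥ 2: for m = 1 only k = 0 is allowed, and the zero outputs A = 0, B = 0 always meet the guarantee with no memory, so the bound fails there. *)

theory Defs
  imports "Jordan_Normal_Form.Char_Poly"
begin

text \<open>
  The list \<open>\<sigma>\<^sub>1 \<ge> \<sigma>\<^sub>2 \<ge> \<dots>\<close> of singular values, with multiplicity: the square roots of the
  eigenvalues of \<open>M\<^sup>T M\<close>. This Gram matrix is real symmetric and positive semidefinite, so its real
  characteristic polynomial splits and the list has length \<^term>\<open>dim_col M\<close>.
\<close>
definition singular_values :: "real mat \<Rightarrow> real list" where
  "singular_values M =
     rev (sorted_list_of_multiset (image_mset sqrt (proots (char_poly (transpose_mat M * M)))))"

text \<open>Indices start at 1, and the value is 0 past the end of the list.\<close>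
definition singular_value :: "nat \<Rightarrow> real mat \<Rightarrow> real" where
  "singular_value i M =
     (if 1 \<le> i \<and> i \<le> length (singular_values M) then singular_values M ! (i - 1) else 0)"

definition spectral_norm :: "real mat \<Rightarrow> real" where
  "spectral_norm M = singular_value 1 M"

definition frobenius_norm :: "real mat \<Rightarrow> real" where
  "frobenius_norm M = sqrt (\<Sum>i<dim_row M. \<Sum>j<dim_col M. (M $$ (i, j))\<^sup>2)"

definition ky_fan_norm :: "nat \<Rightarrow> real mat \<Rightarrow> real" where
  "ky_fan_norm k M = (\<Sum>i=1..k. singular_value i M)"

text \<open>
  \<open>V\<close> is the set of numbers that may occur as entries of an input; \<open>V = UNIV\<close> allows all real
  matrices. For an input with \<open>\<parallel>X\<parallel>\<^sub>F \<parallel>Y\<parallel>\<^sub>F = \<parallel>X\<^sup>T Y\<parallel>\<^sub>k\<close> and \<open>k < m\<close> (if \<open>m \<ge> 2\<close>,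
  take \<open>X = a x\<^sup>T\<close>, \<open>Y = a y\<^sup>T\<close> and \<open>k = 1\<close>), the
  guarantee below forces \<open>A\<^sup>T B = X\<^sup>T Y\<close>. Over \<open>UNIV\<close> no algorithm with finitely many memory states
  can achieve this, whereas for finite \<open>V\<close> (numbers of fixed precision) the guarantee is satisfiable.
\<close>
definition sketch_inputs :: "real set \<Rightarrow> nat \<Rightarrow> nat \<Rightarrow> nat \<Rightarrow> (real mat \<times> real mat) set" where
  "sketch_inputs V n dx dy =
     {(X, Y). X \<in> carrier_mat n dx \<and> Y \<in> carrier_mat n dy \<and>
        elements_mat X \<subseteq> V \<and> elements_mat Y \<subseteq> V}"

type_synonym sketching_algorithm = "real mat \<times> real mat \<Rightarrow> real mat \<times> real mat"

definition sketch_guarantee ::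
  "real set \<Rightarrow> nat \<Rightarrow> nat \<Rightarrow> nat \<Rightarrow> nat \<Rightarrow> sketching_algorithm \<Rightarrow> bool" where
  "sketch_guarantee V n dx dy m alg \<longleftrightarrow>
     (\<forall>X Y A B. (X, Y) \<in> sketch_inputs V n dx dy \<longrightarrow> alg (X, Y) = (A, B) \<longrightarrow>
        A \<in> carrier_mat m dx \<and> B \<in> carrier_mat m dy \<and>
        (\<forall>k<m. spectral_norm (transpose_mat X * Y - transpose_mat A * B)
           \<le> 1 / (real m - real k) *
              (frobenius_norm X * frobenius_norm Y - ky_fan_norm k (transpose_mat X * Y))))"

text \<open>Contents of a memory consisting of \<open>s\<close> words of \<open>w\<close> bits each.\<close>
definition memory_states :: "nat \<Rightarrow> nat \<Rightarrow> bool list list set" where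
  "memory_states w s = {u. length u = s \<and> (\<forall>x\<in>set u. length x = w)}"

text \<open>
  An algorithm works in memory of \<open>s\<close> words of \<open>w\<close> bits on the inputs \<open>I\<close> only if its output is
  determined by the contents of that memory once the input has been processed. No restriction is
  placed on how the contents are computed from the input or decoded into real matrices, so every
  concrete machine model in which the sketch resides in memory is covered.
\<close>
definition works_in_memory ::
  "nat \<Rightarrow> nat \<Rightarrow> (real mat \<times> real mat) set \<Rightarrow> sketching_algorithm \<Rightarrow> bool" where
  "works_in_memory w s I alg \<longleftrightarrow>
     (\<exists>process decode. \<forall>p\<in>I. process p \<in> memory_states w s \<and> alg p = decode (process p))"

end

theory Submission
  imports Defs "Jordan_Normal_Form.Spectral_Radius" "HOL-Analysis.Convex" "HOL-Analysis.L2_Norm"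
begin

text \<open>
  Put \<open>r = \<lfloor>m / 2\<rfloor>\<close> and let \<open>Y\<close> have the rows \<open>e\<^sub>1, \<dots>, e\<^sub>r, 0, \<dots>, 0\<close>. For a 0/1 matrix \<open>X\<close> whose ones
  form a set \<open>S\<close> of cells in the first \<open>r\<close> rows, the columns of \<open>X\<^sup>T Y\<close> are these rows of \<open>X\<close>, and the
  guarantee with \<open>k = 0\<close> bounds the error by \<open>\<surd>(r |S|) / m\<close>. Each column of the error is bounded by
  its spectral norm, so if \<open>S\<close> and \<open>T\<close> lead to the same output then
  \<open>|S \<triangle> T| \<le> r\<^sup>2 / m\<^sup>2 (\<surd>|S| + \<surd>|T|)\<^sup>2 \<le> (\<surd>|S| + \<surd>|T|)\<^sup>2 / 4\<close>. Words of length \<open>L = \<lfloor>r d\<^sub>x / 16\<rfloor>\<close> over 16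
  letters are encoded as sets of \<open>L\<close> cells, one from each of \<open>L\<close> disjoint blocks of 16 cells. Words with
  equal outputs then differ in at most \<open>L / 2\<close> places, so each memory state accounts for at most \<open>8\<^sup>L\<close>
  of the \<open>16\<^sup>L\<close> words, and at least \<open>2\<^sup>L\<close> states are needed. The sets \<open>\<emptyset>\<close> and \<open>{z}\<close> show that at least one
  bit is needed even if \<open>L = 0\<close>. Exchanging the roles of \<open>X\<close> and \<open>Y\<close> gives the bound in \<open>d\<^sub>y\<close>.
\<close>

no_notation inner (infix "\<bullet>" 70)

subsection \<open>Rayleigh quotients and the spectral norm\<close>

text \<open>For a complex eigenvector \<open>v\<close>, moving the transpose across the scalar
  product shows that \<open>e\<close> times the squared norm of \<open>v\<close> is the squared norm
  of \<open>?C *\<^sub>v v\<close>. Hence \<open>e\<close> is a quotient of nonnegative reals.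
  Complex eigenvalues are covered because the spectral radius is taken over them.\<close>

lemma gram_eigenvalue:
  fixes M :: "real mat"
  assumes M: "M \<in> carrier_mat nr n"
    and ev: "eigenvalue (map_mat complex_of_real (transpose_mat M * M)) e"
  shows "\<exists>\<mu>\<ge>0. e = of_real \<mu> \<and> poly (char_poly (transpose_mat M * M)) \<mu> = 0"
proof -
  let ?C = "map_mat complex_of_real M"
  let ?G = "transpose_mat M * M"
  have G: "?G \<in> carrier_mat n n" using M by simp
  have C: "?C \<in> carrier_mat nr n" using M by simp
  have GC: "map_mat complex_of_real ?G = transpose_mat ?C * ?C"
    by (subst of_real_hom.mat_hom_mult[of _ n nr _ n]) (use M in \<open>auto intro!: arg_cong2[where f = "(*)"]\<close>)
  obtain v where v: "v \<in> carrier_vec n" "v \<noteq> 0\<^sub>v n"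
    and eq: "transpose_mat ?C * ?C *\<^sub>v v = e \<cdot>\<^sub>v v"
    using ev G unfolding eigenvalue_def eigenvector_def GC[symmetric] by auto
  \<comment> \<open>The entries of \<open>?C\<close> are real, so its transpose acts as its
    adjoint.\<close>
  have cv: "?C *\<^sub>v conjugate v = conjugate (?C *\<^sub>v v)"
    using M v by (intro eq_vecI) (auto simp: scalar_prod_def sum_conjugate)
  have "e * (v \<bullet>c v) = (transpose_mat ?C *\<^sub>v (?C *\<^sub>v v)) \<bullet>c v"
    using eq v C by (simp add: assoc_mult_mat_vec[of _ n nr _ n])
  also have "\<dots> = (?C *\<^sub>v v) \<bullet>c (?C *\<^sub>v v)"
    using C v by (subst transpose_vec_mult_scalar[of _ nr n]) (auto simp: cv)
  finally have *: "e * (v \<bullet>c v) = (?C *\<^sub>v v) \<bullet>c (?C *\<^sub>v v)" .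
  have "v \<bullet>c v > 0" "(?C *\<^sub>v v) \<bullet>c (?C *\<^sub>v v) \<ge> 0"
    using v C by (auto intro: conjugate_square_ge_0_vec)
  then have "v \<bullet>c v = of_real (Re (v \<bullet>c v))" "Re (v \<bullet>c v) > 0"
      "(?C *\<^sub>v v) \<bullet>c (?C *\<^sub>v v) = of_real (Re ((?C *\<^sub>v v) \<bullet>c (?C *\<^sub>v v)))"
      "Re ((?C *\<^sub>v v) \<bullet>c (?C *\<^sub>v v)) \<ge> 0"
    by (auto simp: complex_eq_iff less_complex_def less_eq_complex_def)
  then obtain a b where ab: "v \<bullet>c v = complex_of_real a" "a > 0"
      "(?C *\<^sub>v v) \<bullet>c (?C *\<^sub>v v) = complex_of_real b" "b \<ge> 0"
    by metis
  then have e: "e = of_real (b / a)"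
    using * by (simp add: field_simps)
  have "poly (char_poly (map_mat complex_of_real ?G)) e = 0"
    using ev eigenvalue_root_char_poly[of "map_mat complex_of_real ?G" n] G by simp
  then have "complex_of_real (poly (char_poly ?G) (b / a)) = 0"
    unfolding of_real_hom.char_poly_hom[OF G] e by (simp del: of_real_divide)
  then show ?thesis using e ab by (intro exI[of _ "b / a"]) auto
qed

lemma scalar_prod_Cauchy_Schwarz:
  fixes v w :: "real vec"
  assumes "v \<in> carrier_vec n" "w \<in> carrier_vec n"
  shows "(v \<bullet> w)\<^sup>2 \<le> (v \<bullet> v) * (w \<bullet> w)"
  using Cauchy_Schwarz_ineq_sum[of "\<lambda>i. v $ i" "\<lambda>i. w $ i" "{0..<n}"] assms
  by (simp add: scalar_prod_def power2_eq_square)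

lemma pow_mat_add:
  assumes "A \<in> carrier_mat n n"
  shows "A ^\<^sub>m (i + j) = A ^\<^sub>m i * A ^\<^sub>m j"
proof (induction j)
  case 0 then show ?case using assms pow_carrier_mat[OF assms, of i] by (simp)
next
  case (Suc j)
  then show ?case using assms by (simp add: assoc_mult_mat[of _ n n _ n _ n])
qed

lemma transpose_pow_mat:
  fixes A :: "'a :: comm_semiring_1 mat"
  assumes "A \<in> carrier_mat n n" "transpose_mat A = A"
  shows "transpose_mat (A ^\<^sub>m k) = A ^\<^sub>m k"
proof (induction k)
  case (Suc k)
  have "transpose_mat (A ^\<^sub>m Suc k) = A * A ^\<^sub>m k"
    using assms Suc by (simp add: transpose_mult[of _ n n _ n])
  also have "\<dots> = A ^\<^sub>m Suc k"
    using pow_mat_add[OF assms(1), of 1 k] pow_mat_add[OF assms(1), of k 1] assms by simp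
  finally show ?case .
qed (use assms in auto)

text \<open>
  Symmetry turns \<open>v \<bullet> G\<^sup>2\<^sup>k v\<close> into \<open>\<parallel>G\<^sup>k v\<parallel>\<^sup>2\<close>, so Cauchy--Schwarz shows that the Rayleigh quotient at
  least squares whenever the exponent doubles.
\<close>
lemma quadratic_form_pow_ge:
  fixes G :: "real mat"
  assumes G: "G \<in> carrier_mat n n" "transpose_mat G = G" and v: "v \<in> carrier_vec n"
    and pos: "v \<bullet> v > 0" "v \<bullet> (G *\<^sub>v v) \<ge> 0"
  shows "(v \<bullet> (G *\<^sub>v v) / (v \<bullet> v)) ^ (2 ^ k) \<le> v \<bullet> (G ^\<^sub>m (2 ^ k) *\<^sub>v v) / (v \<bullet> v)"
proof (induction k)
  case 0
  show ?case using G by simp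
next
  case (Suc k)
  let ?H = "G ^\<^sub>m (2 ^ k)"
  have H: "?H \<in> carrier_mat n n" "transpose_mat ?H = ?H"
    using G transpose_pow_mat by auto
  have "v \<bullet> (G ^\<^sub>m (2 ^ Suc k) *\<^sub>v v) = v \<bullet> (?H *\<^sub>v (?H *\<^sub>v v))"
    using pow_mat_add[OF G(1), of "2 ^ k" "2 ^ k"] H v by (simp add: mult_2 assoc_mult_mat_vec[of _ n n _ n])
  also have "\<dots> = (?H *\<^sub>v v) \<bullet> (?H *\<^sub>v v)"
    using transpose_vec_mult_scalar[OF H(1), of "?H *\<^sub>v v" v] H v by simp
  finally have eq: "v \<bullet> (G ^\<^sub>m (2 ^ Suc k) *\<^sub>v v) = (?H *\<^sub>v v) \<bullet> (?H *\<^sub>v v)" .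
  have "(v \<bullet> (G *\<^sub>v v) / (v \<bullet> v)) ^ (2 ^ Suc k) = ((v \<bullet> (G *\<^sub>v v) / (v \<bullet> v)) ^ (2 ^ k))\<^sup>2"
    by (simp add: power_mult[symmetric] mult.commute)
  also have "\<dots> \<le> (v \<bullet> (?H *\<^sub>v v) / (v \<bullet> v))\<^sup>2"
    by (rule power_mono[OF Suc]) (use pos in auto)
  also have "\<dots> \<le> (?H *\<^sub>v v) \<bullet> (?H *\<^sub>v v) / (v \<bullet> v)"
    using scalar_prod_Cauchy_Schwarz[OF v, of "?H *\<^sub>v v"] H v pos
    by (simp add: power_divide power2_eq_square[of "v \<bullet> v"] divide_simps mult.commute)
  finally show ?case by (simp only: eq)
qed

text \<open>
  If all eigenvalues of the Gram matrix were below 1, its powers would stay bounded, contradicting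
  the growth of the quadratic form. This replaces the spectral theorem.
\<close>
lemma gram_eigenvalue_ge_1:
  fixes M :: "real mat"
  assumes M: "M \<in> carrier_mat nr n" and v: "v \<in> carrier_vec n"
    and less: "v \<bullet> v < (M *\<^sub>v v) \<bullet> (M *\<^sub>v v)"
  shows "\<exists>\<mu>\<ge>1. poly (char_poly (transpose_mat M * M)) \<mu> = 0"
proof (rule ccontr)
  assume no: "\<not> ?thesis"
  let ?G = "transpose_mat M * M"
  let ?C = "map_mat complex_of_real ?G"
  have G: "?G \<in> carrier_mat n n" using M by simp
  have Gt: "transpose_mat ?G = ?G" using M by (simp add: transpose_mult[of _ n nr _ n])
  have C: "?C \<in> carrier_mat n n" using G by simp
  have GM: "v \<bullet> (?G *\<^sub>v v) = (M *\<^sub>v v) \<bullet> (M *\<^sub>v v)"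
    using M v transpose_vec_mult_scalar[OF M v, of "M *\<^sub>v v"] comm_scalar_prod[OF v, of "?G *\<^sub>v v"]
    by (simp add: assoc_mult_mat_vec[of _ n nr _ n])
  \<comment> \<open>If \<open>v\<close> were zero, both sides of \<open>less\<close> would
    vanish.\<close>
  have pos: "v \<bullet> v > 0"
  proof (rule ccontr)
    assume "\<not> v \<bullet> v > 0"
    moreover have "v \<bullet> v \<ge> 0" by (auto simp: scalar_prod_def intro!: sum_nonneg)
    ultimately have "v \<bullet> v = 0" by simp
    then have "\<forall>i<n. v $ i = 0"
      using v by (auto simp: scalar_prod_def sum_nonneg_eq_0_iff)
    then have "v = 0\<^sub>v n" using v by (intro eq_vecI) auto
    then show False using less M by (auto simp: scalar_prod_def)
  qed
  then have n: "n > 0" using v by (cases n) (auto simp: scalar_prod_def)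
  \<comment> \<open>The spectral radius is attained at an eigenvalue, which is a nonnegative real
    root and therefore below 1 by assumption.\<close>
  obtain e where e: "e \<in> spectrum ?C" "norm e = spectral_radius ?C"
    using spectral_radius_mem_max(1)[OF C n] by auto
  obtain \<mu> where "\<mu> \<ge> 0" "e = of_real \<mu>" "poly (char_poly ?G) \<mu> = 0"
    using gram_eigenvalue[OF M, of e] e by (auto simp: spectrum_def)
  moreover from this have "\<mu> < 1" using no not_less by blast
  ultimately have "spectral_radius ?C < 1" using e(2) by simp
  then obtain c where c: "\<And>k. norm_bound (?C ^\<^sub>m k) c"
    using spectral_radius_jnf_norm_bound_less_1_upper_triangular[OF C] by auto
  have entry: "\<bar>(?G ^\<^sub>m k) $$ (i, j)\<bar> \<le> c" if "i < n" "j < n" for i j k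
  proof -
    have "norm ((?C ^\<^sub>m k) $$ (i, j)) \<le> c" using c[of k] that unfolding norm_bound_def pow_mat_dim_square[OF C] by blast
    then show ?thesis
      using that pow_mat_dim_square[OF G, of k]
      unfolding of_real_hom.mat_hom_pow[OF G, symmetric] by simp
  qed
  \<comment> \<open>The entrywise bound \<open>c\<close> holds for all powers, so \<open>B\<close>
    bounds their Rayleigh quotients at \<open>v\<close> uniformly.\<close>
  define B where "B = (\<Sum>i<n. \<Sum>j<n. \<bar>v $ i\<bar> * c * \<bar>v $ j\<bar>) / (v \<bullet> v)"
  have bound: "v \<bullet> (?G ^\<^sub>m k *\<^sub>v v) / (v \<bullet> v) \<le> B" for k
  proof -
    have "v \<bullet> (?G ^\<^sub>m k *\<^sub>v v) = (\<Sum>i<n. \<Sum>j<n. v $ i * (?G ^\<^sub>m k) $$ (i, j) * v $ j)"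
      using v pow_carrier_mat[OF G, of k]
      by (auto simp: scalar_prod_def sum_distrib_left atLeast0LessThan mult.assoc intro!: sum.cong)
    also have "\<dots> \<le> (\<Sum>i<n. \<Sum>j<n. \<bar>v $ i\<bar> * c * \<bar>v $ j\<bar>)"
    proof (intro sum_mono)
      fix i j assume ij: "i \<in> {..<n}" "j \<in> {..<n}"
      have "v $ i * (?G ^\<^sub>m k) $$ (i, j) * v $ j \<le> \<bar>v $ i\<bar> * \<bar>(?G ^\<^sub>m k) $$ (i, j)\<bar> * \<bar>v $ j\<bar>"
        by (metis abs_ge_self abs_mult)
      also have "\<dots> \<le> \<bar>v $ i\<bar> * c * \<bar>v $ j\<bar>"
        using entry[of i j k] ij by (intro mult_right_mono mult_left_mono) auto
      finally show "v $ i * (?G ^\<^sub>m k) $$ (i, j) * v $ j \<le> \<bar>v $ i\<bar> * c * \<bar>v $ j\<bar>" .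
    qed
    finally show ?thesis using pos unfolding B_def by (simp add: divide_right_mono)
  qed
  let ?t = "v \<bullet> (?G *\<^sub>v v) / (v \<bullet> v)"
  have t: "?t > 1" using less pos by (simp only: GM) (simp add: field_simps)
  obtain N where N: "B < ?t ^ N" using real_arch_pow[OF t] by blast
  \<comment> \<open>Growth is known only along exponents \<open>2 ^ N\<close>. As the base exceeds
    1, enlarging the exponent from \<open>N\<close> is harmless.\<close>
  have "?t ^ N \<le> ?t ^ (2 ^ N)" using t by (intro power_increasing) (auto intro: less_imp_le)
  also have "\<dots> \<le> v \<bullet> (?G ^\<^sub>m (2 ^ N) *\<^sub>v v) / (v \<bullet> v)"
    using less pos GM by (intro quadratic_form_pow_ge[OF G Gt v]) auto
  also have "\<dots> \<le> B" by (rule bound)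
  finally show False using N by simp
qed

text \<open>The characteristic polynomial is monic, hence nonzero, so its roots all occur in
  \<open>proots\<close>. The first singular value is the last entry of the ascending list
  \<open>xs\<close>, which dominates every other entry.\<close>

lemma sqrt_root_le_spectral_norm:
  fixes M :: "real mat"
  assumes "poly (char_poly (transpose_mat M * M)) \<mu> = 0"
  shows "sqrt \<mu> \<le> spectral_norm M"
proof -
  define p where "p = char_poly (transpose_mat M * M)"
  define xs where "xs = sorted_list_of_multiset (image_mset sqrt (proots p))"
  have "transpose_mat M * M \<in> carrier_mat (dim_col M) (dim_col M)" by (rule carrier_matI) simp_all
  from degree_monic_char_poly[OF this] have "p \<noteq> 0" unfolding p_def by auto
  then have "\<mu> \<in># proots p" using assms unfolding p_def by simp
  then have mem: "sqrt \<mu> \<in> set xs" by (simp add: xs_def)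
  then have ne: "xs \<noteq> []" by auto
  obtain i where i: "i < length xs" "xs ! i = sqrt \<mu>" using mem by (auto simp: in_set_conv_nth)
  have "sorted xs" unfolding xs_def by (rule sorted_sorted_list_of_multiset)
  then have "xs ! i \<le> xs ! (length xs - 1)" using i(1) by (intro sorted_nth_mono) auto
  then have "sqrt \<mu> \<le> last xs" using i(2) ne by (simp add: last_conv_nth)
  then show ?thesis
    using ne unfolding spectral_norm_def singular_value_def singular_values_def p_def[symmetric] xs_def[symmetric]
    by (simp add: Suc_le_eq rev_nth last_conv_nth)
qed

text \<open>\<open>sqrt\<close> is odd and so negative on negative arguments; the claim thus rests
  on the roots being nonnegative, obtained from \<open>gram_eigenvalue\<close> by complexification.
  An empty list yields the default 0.\<close>

lemma spectral_norm_nonneg: "spectral_norm M \<ge> 0"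
proof -
  let ?G = "transpose_mat M * M"
  have G: "?G \<in> carrier_mat (dim_col M) (dim_col M)" by (rule carrier_matI) simp_all
  have root_nonneg: "\<mu> \<ge> 0" if "poly (char_poly ?G) \<mu> = 0" for \<mu>
  proof -
    have "poly (char_poly (map_mat complex_of_real ?G)) (of_real \<mu>) = 0"
      unfolding of_real_hom.char_poly_hom[OF G] using that by simp
    then have "eigenvalue (map_mat complex_of_real ?G) (of_real \<mu>)"
      by (subst eigenvalue_root_char_poly) (use G in auto)
    then show ?thesis using gram_eigenvalue[of M "dim_row M" "dim_col M"] by force
  qed
  have "char_poly ?G \<noteq> 0" using degree_monic_char_poly[OF G] by auto
  then have nonneg: "x \<ge> 0" if "x \<in> set (singular_values M)" for x
    using that root_nonneg unfolding singular_values_def by auto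
  show ?thesis
    unfolding spectral_norm_def singular_value_def by (auto intro!: nonneg nth_mem)
qed

text \<open>By rescaling: if the bound failed, some \<open>\<rho>\<close> above the squared spectral
  norm would still lie below the Rayleigh quotient. Dividing \<open>M\<close> by
  \<open>sqrt \<rho>\<close> then gives a Gram eigenvalue \<open>\<mu> \<ge> 1\<close>, so
  \<open>\<rho> * \<mu>\<close> is an eigenvalue of \<open>?G\<close> that is too large.\<close>

lemma mult_mat_vec_le_spectral_norm:
  fixes M :: "real mat"
  assumes M: "M \<in> carrier_mat nr n" and v: "v \<in> carrier_vec n"
  shows "(M *\<^sub>v v) \<bullet> (M *\<^sub>v v) \<le> (spectral_norm M)\<^sup>2 * (v \<bullet> v)"
proof (rule ccontr)
  let ?G = "transpose_mat M * M" and ?a = "(M *\<^sub>v v) \<bullet> (M *\<^sub>v v)" and ?s = "(spectral_norm M)\<^sup>2"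
  assume "\<not> ?thesis"
  then have less: "?s * (v \<bullet> v) < ?a" by simp
  \<comment> \<open>If \<open>v \<bullet> v = 0\<close>, the product with \<open>\<rho>\<close> is 0
    and any number above \<open>?s\<close> serves; otherwise density supplies one below the
    quotient.\<close>
  obtain \<rho> where \<rho>: "?s < \<rho>" "\<rho> * (v \<bullet> v) < ?a"
  proof (cases "v \<bullet> v = 0")
    case True then show ?thesis using less by (intro that[of "?s + 1"]) auto
  next
    case False
    moreover have "v \<bullet> v \<ge> 0" by (auto simp: scalar_prod_def intro!: sum_nonneg)
    ultimately have pos: "v \<bullet> v > 0" by simp
    then have "?s < ?a / (v \<bullet> v)" using less by (simp add: field_simps)
    then obtain \<rho> where "?s < \<rho>" "\<rho> < ?a / (v \<bullet> v)" using dense by blast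
    then show ?thesis using pos by (intro that[of \<rho>]) (auto simp: field_simps)
  qed
  have \<rho>0: "\<rho> > 0" using \<rho>(1) by (meson le_less_trans zero_le_power2)
  define M' where "M' = (1 / sqrt \<rho>) \<cdot>\<^sub>m M"
  have M': "M' \<in> carrier_mat nr n" using M by (simp add: M'_def)
  have G: "?G \<in> carrier_mat n n" using M by simp
  have G': "transpose_mat M' * M' = (1 / \<rho>) \<cdot>\<^sub>m ?G"
    using M \<rho>0 by (intro eq_matI) (auto simp: M'_def scalar_prod_def sum_divide_distrib field_simps)
  have "(M' *\<^sub>v v) \<bullet> (M' *\<^sub>v v) = ?a / \<rho>"
    using M v \<rho>0 by (auto simp: M'_def scalar_prod_def sum_divide_distrib[symmetric] field_simps sum_distrib_left)
  then have "\<rho> * (v \<bullet> v) < \<rho> * ((M' *\<^sub>v v) \<bullet> (M' *\<^sub>v v))" using \<rho>(2) \<rho>0 by simp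
  then have "v \<bullet> v < (M' *\<^sub>v v) \<bullet> (M' *\<^sub>v v)" using \<rho>0 by simp
  then obtain \<mu> where \<mu>: "\<mu> \<ge> 1" "poly (char_poly (transpose_mat M' * M')) \<mu> = 0"
    using gram_eigenvalue_ge_1[OF M' v] by auto
  have "eigenvalue ((1 / \<rho>) \<cdot>\<^sub>m ?G) \<mu>"
    using \<mu>(2) eigenvalue_root_char_poly[of "(1 / \<rho>) \<cdot>\<^sub>m ?G" n \<mu>] G by (simp add: G')
  then obtain w where w: "w \<in> carrier_vec n" "w \<noteq> 0\<^sub>v n" "((1 / \<rho>) \<cdot>\<^sub>m ?G) *\<^sub>v w = \<mu> \<cdot>\<^sub>v w"
    using G unfolding eigenvalue_def eigenvector_def by auto
  have "?G *\<^sub>v w = \<rho> \<cdot>\<^sub>v (((1 / \<rho>) \<cdot>\<^sub>m ?G) *\<^sub>v w)"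
    using G w(1) \<rho>0 by (intro eq_vecI) (auto simp: smult_scalar_prod_distrib[of _ n])
  also have "\<dots> = (\<rho> * \<mu>) \<cdot>\<^sub>v w" unfolding w(3) by (simp add: smult_smult_assoc)
  finally have "eigenvalue ?G (\<rho> * \<mu>)"
    using w G M unfolding eigenvalue_def eigenvector_def by auto
  then have "sqrt (\<rho> * \<mu>) \<le> spectral_norm M"
    using eigenvalue_root_char_poly[OF G] sqrt_root_le_spectral_norm by blast
  then have "(sqrt (\<rho> * \<mu>))\<^sup>2 \<le> ?s" using \<rho>0 \<mu>(1) by (intro power_mono) auto
  then have "\<rho> * \<mu> \<le> ?s" using \<rho>0 \<mu>(1) by simp
  moreover have "\<rho> \<le> \<rho> * \<mu>" using \<mu>(1) \<rho>0 by simp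
  ultimately show False using \<rho>(1) by linarith
qed

section \<open>Euclidean norms of columns and rows\<close>

lemma col_norm_le_spectral_norm:
  assumes M: "M \<in> carrier_mat nr n" and b: "b < n"
  shows "L2_set (\<lambda>a. M $$ (a, b)) {..<nr} \<le> spectral_norm M"
proof -
  have "M *\<^sub>v unit_vec n b = col M b" using M b by (intro eq_vecI) auto
  moreover have "col M b \<bullet> col M b = (\<Sum>a<nr. (M $$ (a, b))\<^sup>2)"
    using M b by (simp add: scalar_prod_def power2_eq_square atLeast0LessThan)
  moreover have "unit_vec n b \<bullet> unit_vec n b = (1 :: real)" using b by simp
  ultimately have "(\<Sum>a<nr. (M $$ (a, b))\<^sup>2) \<le> (spectral_norm M)\<^sup>2"
    using mult_mat_vec_le_spectral_norm[OF M, of "unit_vec n b"] by simp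
  then show ?thesis unfolding L2_set_def by (intro real_le_lsqrt) (auto intro: spectral_norm_nonneg sum_nonneg)
qed

text \<open>Apply \<open>M\<close> to its own row: entry \<open>a\<close> of the image is
  \<open>?q\<close>, so \<open>?q\<^sup>2\<close> is at most the squared spectral norm times
  \<open>?q\<close>, and one factor cancels. This needs no comparison with the transpose.\<close>

lemma row_norm_le_spectral_norm:
  assumes M: "M \<in> carrier_mat nr n" and a: "a < nr"
  shows "L2_set (\<lambda>b. M $$ (a, b)) {..<n} \<le> spectral_norm M"
proof -
  let ?v = "row M a"
  let ?q = "?v \<bullet> ?v"
  have q: "?q = (\<Sum>b<n. (M $$ (a, b))\<^sup>2)"
    using M a by (simp add: scalar_prod_def power2_eq_square atLeast0LessThan)
  then have q0: "?q \<ge> 0" by (simp add: sum_nonneg)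
  have "?q\<^sup>2 = ((M *\<^sub>v ?v) $ a)\<^sup>2" using M a by simp
  also have "\<dots> \<le> (\<Sum>i<nr. ((M *\<^sub>v ?v) $ i)\<^sup>2)" using a by (intro member_le_sum) auto
  also have "\<dots> = (M *\<^sub>v ?v) \<bullet> (M *\<^sub>v ?v)"
    using M by (simp add: scalar_prod_def power2_eq_square atLeast0LessThan)
  also have "\<dots> \<le> (spectral_norm M)\<^sup>2 * ?q"
    using M a by (intro mult_mat_vec_le_spectral_norm[OF M]) auto
  finally have "?q * ?q \<le> (spectral_norm M)\<^sup>2 * ?q" by (simp add: power2_eq_square)
  then have "?q \<le> (spectral_norm M)\<^sup>2" using q0 by (cases "?q = 0") auto
  then show ?thesis unfolding L2_set_def q by (intro real_le_lsqrt) (auto intro: spectral_norm_nonneg sum_nonneg)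
qed

lemma L2_set_diff_le:
  "L2_set (\<lambda>i. f i - g i) A \<le> L2_set (\<lambda>i. f i - h i) A + L2_set (\<lambda>i. g i - h i) A"
proof -
  have "L2_set (\<lambda>i. (f i - h i) + - (g i - h i)) A
      \<le> L2_set (\<lambda>i. f i - h i) A + L2_set (\<lambda>i. - (g i - h i)) A"
    by (rule L2_set_triangle_ineq)
  then show ?thesis by (simp add: L2_set_def power2_commute[of "h _"])
qed

text \<open>Used with \<open>C\<close> the product decoded from a sketch shared by two inputs with
  exact products \<open>P\<close> and \<open>Q\<close>: the triangle inequality through
  \<open>C\<close> keeps their columns close.\<close>

lemma col_diff_le_spectral_norm:
  assumes M: "P \<in> carrier_mat nr n" "Q \<in> carrier_mat nr n" "C \<in> carrier_mat nr n" and b: "b < n"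
  shows "(\<Sum>a<nr. (P $$ (a, b) - Q $$ (a, b))\<^sup>2) \<le> (spectral_norm (P - C) + spectral_norm (Q - C))\<^sup>2"
proof -
  have "L2_set (\<lambda>a. P $$ (a, b) - Q $$ (a, b)) {..<nr}
      \<le> L2_set (\<lambda>a. P $$ (a, b) - C $$ (a, b)) {..<nr} + L2_set (\<lambda>a. Q $$ (a, b) - C $$ (a, b)) {..<nr}"
    by (rule L2_set_diff_le)
  also have "L2_set (\<lambda>a. P $$ (a, b) - C $$ (a, b)) {..<nr} = L2_set (\<lambda>a. (P - C) $$ (a, b)) {..<nr}"
    using M b by (intro L2_set_cong) auto
  also have "L2_set (\<lambda>a. Q $$ (a, b) - C $$ (a, b)) {..<nr} = L2_set (\<lambda>a. (Q - C) $$ (a, b)) {..<nr}"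
    using M b by (intro L2_set_cong) auto
  also have "L2_set (\<lambda>a. (P - C) $$ (a, b)) {..<nr} + L2_set (\<lambda>a. (Q - C) $$ (a, b)) {..<nr}
      \<le> spectral_norm (P - C) + spectral_norm (Q - C)"
    using M b by (intro add_mono col_norm_le_spectral_norm[of _ _ n]) auto
  finally show ?thesis unfolding L2_set_def by (rule sqrt_le_D)
qed

lemma row_diff_le_spectral_norm:
  assumes M: "P \<in> carrier_mat nr n" "Q \<in> carrier_mat nr n" "C \<in> carrier_mat nr n" and a: "a < nr"
  shows "(\<Sum>b<n. (P $$ (a, b) - Q $$ (a, b))\<^sup>2) \<le> (spectral_norm (P - C) + spectral_norm (Q - C))\<^sup>2"
proof -
  have "L2_set (\<lambda>b. P $$ (a, b) - Q $$ (a, b)) {..<n}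
      \<le> L2_set (\<lambda>b. P $$ (a, b) - C $$ (a, b)) {..<n} + L2_set (\<lambda>b. Q $$ (a, b) - C $$ (a, b)) {..<n}"
    by (rule L2_set_diff_le)
  also have "L2_set (\<lambda>b. P $$ (a, b) - C $$ (a, b)) {..<n} = L2_set (\<lambda>b. (P - C) $$ (a, b)) {..<n}"
    using M a by (intro L2_set_cong) auto
  also have "L2_set (\<lambda>b. Q $$ (a, b) - C $$ (a, b)) {..<n} = L2_set (\<lambda>b. (Q - C) $$ (a, b)) {..<n}"
    using M a by (intro L2_set_cong) auto
  also have "L2_set (\<lambda>b. (P - C) $$ (a, b)) {..<n} + L2_set (\<lambda>b. (Q - C) $$ (a, b)) {..<n}
      \<le> spectral_norm (P - C) + spectral_norm (Q - C)"
    using M a by (intro add_mono row_norm_le_spectral_norm[of _ nr]) auto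
  finally show ?thesis unfolding L2_set_def by (rule sqrt_le_D)
qed

subsection \<open>Counting memory states\<close>

text \<open>Sort the words by the set \<open>D\<close> of positions where they differ from
  \<open>x\<close>: there are at most \<open>2 ^ L\<close> such sets, each allowing at most
  \<open>16 ^ card D \<le> 4 ^ L\<close> words.\<close>

lemma card_hamming_ball_le:
  fixes x :: "nat \<Rightarrow> nat"
  shows "card {y \<in> {..<L} \<rightarrow>\<^sub>E {..<16}. 2 * card {i \<in> {..<L}. x i \<noteq> y i} \<le> L} \<le> 8 ^ L"
    (is "card ?B \<le> _")
proof -
  \<comment> \<open>Words that agree with \<open>x\<close> outside \<open>D\<close> and are
    arbitrary on \<open>D\<close>.\<close>
  define E :: "nat set \<Rightarrow> (nat \<Rightarrow> nat) set"
    where "E = (\<lambda>D. PiE {..<L} (\<lambda>i. if i \<in> D then {..<16} else {x i}))"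
  define \<D> where "\<D> = {D \<in> Pow {..<L}. 2 * card D \<le> L}"
  have fin: "finite \<D>" unfolding \<D>_def by simp
  have cardE: "card (E D) \<le> 4 ^ L" if "D \<in> \<D>" for D
  proof -
    have D: "D \<subseteq> {..<L}" "2 * card D \<le> L" using that by (auto simp: \<D>_def)
    have "card (E D) = (\<Prod>i<L. if i \<in> D then 16 else 1)"
      unfolding E_def by (subst card_PiE) (auto intro!: prod.cong)
    also have "\<dots> = 16 ^ card D"
      using D by (simp add: prod.If_cases Int_absorb1)
    also have "\<dots> = 4 ^ (2 * card D)" by (simp add: power_mult)
    also have "\<dots> \<le> 4 ^ L" using D by (intro power_increasing) auto
    finally show ?thesis .
  qed
  have finE: "finite (E D)" for D
    unfolding E_def by (intro finite_PiE) auto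
  have "?B \<subseteq> (\<Union>D\<in>\<D>. E D)"
  proof
    fix y assume y: "y \<in> ?B"
    then have "{i \<in> {..<L}. x i \<noteq> y i} \<in> \<D>" "y \<in> E {i \<in> {..<L}. x i \<noteq> y i}"
      by (auto simp: \<D>_def E_def PiE_iff)
    then show "y \<in> (\<Union>D\<in>\<D>. E D)" by blast
  qed
  then have "card ?B \<le> card (\<Union>D\<in>\<D>. E D)"
    using fin finE by (intro card_mono) auto
  also have "\<dots> \<le> (\<Sum>D\<in>\<D>. card (E D))" by (rule card_UN_le[OF fin])
  also have "\<dots> \<le> card \<D> * 4 ^ L" using sum_bounded_above[of \<D> "\<lambda>D. card (E D)"] cardE by simp
  also have "\<dots> \<le> 2 ^ L * 4 ^ L"
    using card_mono[of "Pow {..<L}" \<D>] by (intro mult_right_mono) (auto simp: \<D>_def card_Pow)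
  also have "\<dots> = 8 ^ L" by (simp add: power_mult_distrib[symmetric])
  finally show ?thesis .
qed

text \<open>The code yields \<open>L \<le> b\<close> for \<open>L = card R div 16\<close>. Rounding
  costs fewer than 16 cells, absorbed by another \<open>16 * b\<close> because
  \<open>b \<ge> 1\<close>; hence the factor 32.\<close>

lemma card_le_of_separating:
  fixes f :: "'a set \<Rightarrow> 'b"
  assumes R: "finite R" "R \<noteq> {}" and U: "finite U" "card U = 2 ^ b"
    and fU: "\<And>S. S \<subseteq> R \<Longrightarrow> f S \<in> U"
    and sep: "\<And>S T. S \<subseteq> R \<Longrightarrow> T \<subseteq> R \<Longrightarrow> f S = f T \<Longrightarrow>
      4 * real (card (S - T) + card (T - S)) \<le> (sqrt (card S) + sqrt (card T))\<^sup>2"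
  shows "card R \<le> 32 * b"
proof -
  \<comment> \<open>With a single state, \<open>{}\<close> and \<open>{z}\<close> would collide, and
    \<open>sep\<close> would read \<open>4 \<le> 1\<close>.\<close>
  have "b \<noteq> 0"
  proof
    assume "b = 0"
    then obtain u where "U = {u}" using U by (auto simp: card_1_singleton_iff)
    moreover obtain z where "z \<in> R" using R by blast
    ultimately show False using fU[of "{}"] fU[of "{z}"] sep[of "{}" "{z}"] by simp
  qed
  define L where "L = card R div 16"
  \<comment> \<open>\<open>g\<close> places \<open>L\<close> disjoint blocks of 16 cells in
    \<open>R\<close>; \<open>F x\<close> picks in block \<open>i\<close> the cell with letter
    \<open>x i\<close>.\<close>
  have "card ({..<L} \<times> {..<16::nat}) \<le> card R" by (simp add: L_def)
  then obtain g where g: "g ` ({..<L} \<times> {..<16::nat}) \<subseteq> R" "inj_on g ({..<L} \<times> {..<16::nat})"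
    using card_le_inj[of "{..<L} \<times> {..<16::nat}" R] R by auto
  define W where "W = {..<L} \<rightarrow>\<^sub>E {..<16::nat}"
  define F where "F x = (\<lambda>i. g (i, x i)) ` {..<L}" for x
  have FR: "F x \<subseteq> R" if "x \<in> W" for x
    using that g(1) unfolding F_def W_def by (auto simp: PiE_iff)
  have inj: "inj_on (\<lambda>i. g (i, x i)) {..<L}" if "x \<in> W" for x
    using that inj_onD[OF g(2)] unfolding W_def by (intro inj_onI) (auto simp: PiE_iff dest: inj_onD[OF g(2)])
  have cardF: "card (F x) = L" if "x \<in> W" for x
    using card_image[OF inj[OF that]] by (simp add: F_def)
  have diff: "card {i \<in> {..<L}. x i \<noteq> y i} \<le> card (F x - F y)" if "x \<in> W" "y \<in> W" for x y
  proof -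
    let ?D = "{i \<in> {..<L}. x i \<noteq> y i}"
    have "(\<lambda>i. g (i, x i)) ` ?D \<subseteq> F x - F y"
      using that unfolding F_def W_def by (auto simp: PiE_iff dest: inj_onD[OF g(2)])
    then have "card ((\<lambda>i. g (i, x i)) ` ?D) \<le> card (F x - F y)"
      by (intro card_mono) (auto simp: F_def)
    then show ?thesis
      using card_image[OF inj_on_subset[OF inj[OF that(1)], of ?D]] by (simp add: subset_eq)
  qed
  have close: "2 * card {i \<in> {..<L}. x i \<noteq> y i} \<le> L"
    if xy: "x \<in> W" "y \<in> W" and "f (F x) = f (F y)" for x y
  proof -
    \<comment> \<open>Both sets have \<open>L\<close> elements, so the right side of
      \<open>sep\<close> is \<open>(2 * sqrt L)\<^sup>2\<close>. Each differing position is counted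
      in both set differences, whence the factor 2 in \<open>close\<close>.\<close>
    have "4 * real (card (F x - F y) + card (F y - F x)) \<le> 4 * real L"
      using sep[of "F x" "F y"] FR that by (simp add: cardF power2_eq_square)
    then have "card (F x - F y) + card (F y - F x) \<le> L" by (simp del: of_nat_add)
    moreover have "{i \<in> {..<L}. y i \<noteq> x i} = {i \<in> {..<L}. x i \<noteq> y i}" by auto
    ultimately show ?thesis using diff[OF xy] diff[OF xy(2,1)] by simp
  qed
  have finW: "finite W" unfolding W_def by (intro finite_PiE) auto
  \<comment> \<open>A nonempty fibre lies in the Hamming ball around any one of its members.\<close>
  have fibre: "card {x \<in> W. f (F x) = u} \<le> 8 ^ L" for u
  proof (cases "\<exists>x. x \<in> W \<and> f (F x) = u")
    case True
    then obtain x where x: "x \<in> W" "f (F x) = u" by blast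
    then have "{y \<in> W. f (F y) = u} \<subseteq> {y \<in> W. 2 * card {i \<in> {..<L}. x i \<noteq> y i} \<le> L}"
      using close by auto
    then have "card {y \<in> W. f (F y) = u} \<le> card {y \<in> W. 2 * card {i \<in> {..<L}. x i \<noteq> y i} \<le> L}"
      using finW by (intro card_mono) auto
    then show ?thesis using card_hamming_ball_le[of L x] unfolding W_def by linarith
  next
    case False
    then have "{x \<in> W. f (F x) = u} = {}" by auto
    then show ?thesis by (simp only:) simp
  qed
  have "16 ^ L = card W" unfolding W_def by (simp add: card_PiE)
  also have "W = (\<Union>u\<in>U. {x \<in> W. f (F x) = u})" using fU FR by auto
  also have "card \<dots> \<le> (\<Sum>u\<in>U. card {x \<in> W. f (F x) = u})" by (rule card_UN_le[OF U(1)])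
  also have "\<dots> \<le> card U * 8 ^ L"
    using sum_bounded_above[of U "\<lambda>u. card {x \<in> W. f (F x) = u}" "8 ^ L"] fibre by simp
  finally have "(16::nat) ^ L \<le> 2 ^ b * 8 ^ L" using U by simp
  moreover have "(16::nat) ^ L = 2 ^ L * 8 ^ L" by (simp add: power_mult_distrib[symmetric])
  ultimately have "(2::nat) ^ L \<le> 2 ^ b" by simp
  then have "L \<le> b" by simp
  moreover have "card R < 16 * L + 16"
    unfolding L_def using div_mult_mod_eq[of "card R" 16] mod_less_divisor[of 16 "card R"] by linarith
  ultimately show ?thesis using \<open>b \<noteq> 0\<close> by linarith
qed

lemma finite_memory_states: "finite (memory_states w s)"
  and card_memory_states: "card (memory_states w s) = 2 ^ (w * s)"
proof -
  let ?A = "{x::bool list. set x \<subseteq> UNIV \<and> length x = w}"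
  have A: "finite ?A" "card ?A = 2 ^ w"
    using finite_lists_length_eq[of "UNIV::bool set" w] card_lists_length_eq[of "UNIV::bool set" w] by auto
  have eq: "memory_states w s = {u. set u \<subseteq> ?A \<and> length u = s}"
    unfolding memory_states_def by auto
  show "finite (memory_states w s)" "card (memory_states w s) = 2 ^ (w * s)"
    unfolding eq using finite_lists_length_eq[OF A(1)] card_lists_length_eq[OF A(1)] A(2)
    by (simp_all add: power_mult)
qed

subsection \<open>Sketches of 0/1 matrices\<close>

text \<open>Indexing 0/1 inputs by sets of cells turns squared Frobenius norms and squared distances
  into cardinalities.\<close>

definition indicator_mat :: "nat \<Rightarrow> nat \<Rightarrow> (nat \<times> nat) set \<Rightarrow> real mat" where
  "indicator_mat nr nc S = mat nr nc (\<lambda>ij. of_bool (ij \<in> S))"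

lemma indicator_mat_carrier [simp]: "indicator_mat nr nc S \<in> carrier_mat nr nc"
  by (simp add: indicator_mat_def)

lemma indicator_mat_index [simp]:
  "i < nr \<Longrightarrow> j < nc \<Longrightarrow> indicator_mat nr nc S $$ (i, j) = of_bool ((i, j) \<in> S)"
  by (simp add: indicator_mat_def)

lemma indicator_mat_in_sketch_inputs:
  assumes "{0, 1} \<subseteq> V"
  shows "(indicator_mat n dx S, indicator_mat n dy T) \<in> sketch_inputs V n dx dy"
  using assms unfolding sketch_inputs_def
  by (auto dest!: elements_matD simp: indicator_mat_def)

lemma frobenius_norm_indicator_mat:
  assumes "S \<subseteq> {..<nr} \<times> {..<nc}"
  shows "frobenius_norm (indicator_mat nr nc S) = sqrt (card S)"
proof -
  have "(\<Sum>i<nr. \<Sum>j<nc. (indicator_mat nr nc S $$ (i, j))\<^sup>2)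
      = (\<Sum>ij\<in>{..<nr} \<times> {..<nc}. of_bool (ij \<in> S))"
    unfolding sum.cartesian_product by (intro sum.cong) auto
  also have "\<dots> = card S" using assms by (simp add: Int_absorb1 of_bool_def sum.If_cases)
  finally show ?thesis by (simp add: frobenius_norm_def indicator_mat_def)
qed

lemma card_symmetric_difference:
  assumes "finite A" "S \<subseteq> A" "T \<subseteq> A"
  shows "real (card (S - T) + card (T - S)) = (\<Sum>p\<in>A. (of_bool (p \<in> S) - of_bool (p \<in> T))\<^sup>2)"
proof -
  have "(\<Sum>p\<in>A. (of_bool (p \<in> S) - of_bool (p \<in> T))\<^sup>2)
      = (\<Sum>p\<in>A. of_bool (p \<in> S - T) + of_bool (p \<in> T - S) :: real)"
    by (intro sum.cong) auto
  also have "\<dots> = card (A \<inter> (S - T)) + card (A \<inter> (T - S))"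
    using assms(1) by (simp add: sum.distrib of_bool_def sum.If_cases) (simp add: set_diff_eq)
  also have "A \<inter> (S - T) = S - T" using assms by auto
  also have "A \<inter> (T - S) = T - S" using assms by auto
  finally show ?thesis by simp
qed

section \<open>Inputs with equal sketches are close\<close>

lemma sketch_guarantee_spectral_norm_le:
  assumes "sketch_guarantee V n dx dy m alg" "0 < m" "(X, Y) \<in> sketch_inputs V n dx dy"
    "alg (X, Y) = (A, B)"
  shows "transpose_mat A * B \<in> carrier_mat dx dy"
    "spectral_norm (transpose_mat X * Y - transpose_mat A * B)
      \<le> frobenius_norm X * frobenius_norm Y / real m"
proof -
  \<comment> \<open>The instance \<open>k = 0\<close>, where the Ky Fan norm is an empty
    sum.\<close>
  have "A \<in> carrier_mat m dx \<and> B \<in> carrier_mat m dy \<and>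
      spectral_norm (transpose_mat X * Y - transpose_mat A * B)
        \<le> 1 / (real m - real 0) * (frobenius_norm X * frobenius_norm Y - ky_fan_norm 0 (transpose_mat X * Y))"
    using assms unfolding sketch_guarantee_def by blast
  then show "transpose_mat A * B \<in> carrier_mat dx dy"
    "spectral_norm (transpose_mat X * Y - transpose_mat A * B)
      \<le> frobenius_norm X * frobenius_norm Y / real m"
    by (auto simp: ky_fan_norm_def)
qed

text \<open>One factor \<open>r\<close> comes from adding up \<open>r\<close> columns or rows, the
  other from the squared Frobenius norm of the identity block. Together they give
  \<open>(2 * r / m)\<^sup>2\<close>, at most 1 because \<open>r\<close> is at most half of
  \<open>m\<close>.\<close>

lemma separation_bound:
  fixes p q e f :: real
  assumes d: "d \<le> real r * (e + f)\<^sup>2" and r: "2 * r \<le> m" and m: "0 < m"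
    and e: "0 \<le> e" "e \<le> sqrt p * sqrt (real r) / real m"
    and f: "0 \<le> f" "f \<le> sqrt q * sqrt (real r) / real m"
  shows "4 * d \<le> (sqrt p + sqrt q)\<^sup>2"
proof -
  let ?s = "sqrt p + sqrt q"
  have ef: "e + f \<le> ?s * sqrt (real r) / real m"
    using e f by (simp add: add_divide_distrib distrib_right)
  have "4 * d \<le> 4 * (real r * (e + f)\<^sup>2)" using d by simp
  also have "\<dots> \<le> 4 * (real r * (?s * sqrt (real r) / real m)\<^sup>2)"
    using e f ef by (intro mult_left_mono power_mono) auto
  also have "\<dots> = (real (2 * r) / real m)\<^sup>2 * ?s\<^sup>2"
    by (simp add: power_divide power_mult_distrib power2_eq_square[of "real r"])
  also have "\<dots> \<le> 1 * ?s\<^sup>2"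
    using r m by (intro mult_right_mono power_le_one) (auto simp: field_simps)
  finally show ?thesis by simp
qed

lemma indicator_mat_mult_Id_on:
  assumes "r \<le> n" "r \<le> dy" "S \<subseteq> {..<r} \<times> {..<dx}"
  shows "transpose_mat (indicator_mat n dx S) * indicator_mat n dy (Id_on {..<r})
    = indicator_mat dx dy (S\<inverse>)"
proof (intro eq_matI)
  fix a b assume "a < dim_row (indicator_mat dx dy (S\<inverse>))" "b < dim_col (indicator_mat dx dy (S\<inverse>))"
  then have ab: "a < dx" "b < dy" by (auto simp: indicator_mat_def)
  have "(transpose_mat (indicator_mat n dx S) * indicator_mat n dy (Id_on {..<r})) $$ (a, b)
      = (\<Sum>i<n. of_bool ((i, a) \<in> S) * of_bool ((i, b) \<in> Id_on {..<r}))"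
    using ab by (auto simp: indicator_mat_def scalar_prod_def atLeast0LessThan intro!: sum.cong)
  \<comment> \<open>For \<open>b \<ge> r\<close> the term \<open>i = b\<close> vanishes on both
    sides, since \<open>S\<close> has cells only in rows below \<open>r\<close>.\<close>
  also have "\<dots> = (\<Sum>i<n. if i = b then of_bool ((b, a) \<in> S) else 0)"
    using assms by (intro sum.cong) auto
  also have "\<dots> = indicator_mat dx dy (S\<inverse>) $$ (a, b)"
    using assms ab by auto
  finally show "(transpose_mat (indicator_mat n dx S) * indicator_mat n dy (Id_on {..<r})) $$ (a, b)
      = indicator_mat dx dy (S\<inverse>) $$ (a, b)" .
qed (auto simp: indicator_mat_def)

lemma Id_on_mult_indicator_mat:
  assumes "r \<le> n" "r \<le> dx" "S \<subseteq> {..<r} \<times> {..<dy}"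
  shows "transpose_mat (indicator_mat n dx (Id_on {..<r})) * indicator_mat n dy S
    = indicator_mat dx dy S"
proof (intro eq_matI)
  fix a b assume "a < dim_row (indicator_mat dx dy S)" "b < dim_col (indicator_mat dx dy S)"
  then have ab: "a < dx" "b < dy" by (auto simp: indicator_mat_def)
  have "(transpose_mat (indicator_mat n dx (Id_on {..<r})) * indicator_mat n dy S) $$ (a, b)
      = (\<Sum>i<n. of_bool ((i, a) \<in> Id_on {..<r}) * of_bool ((i, b) \<in> S))"
    using ab by (auto simp: indicator_mat_def scalar_prod_def atLeast0LessThan intro!: sum.cong)
  also have "\<dots> = (\<Sum>i<n. if i = a then of_bool ((a, b) \<in> S) else 0)"
    using assms by (intro sum.cong) auto
  also have "\<dots> = indicator_mat dx dy S $$ (a, b)"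
    using assms ab by auto
  finally show "(transpose_mat (indicator_mat n dx (Id_on {..<r})) * indicator_mat n dy S) $$ (a, b)
      = indicator_mat dx dy S $$ (a, b)" .
qed (auto simp: indicator_mat_def)

lemma frobenius_norm_Id_on:
  assumes "r \<le> n" "r \<le> d"
  shows "frobenius_norm (indicator_mat n d (Id_on {..<r})) = sqrt (real r)"
proof -
  have "Id_on {..<r} = (\<lambda>i. (i, i)) ` {..<r}" by auto
  then have "card (Id_on {..<r}) = r" by (simp add: card_image inj_on_def)
  then show ?thesis using assms by (subst frobenius_norm_indicator_mat) auto
qed

text \<open>Equal outputs mean one common approximation \<open>?C\<close> of both products. The
  cells of \<open>S\<close> and \<open>T\<close> occupy only the first \<open>r\<close> columns of
  these products, so just \<open>r\<close> column errors are added.\<close>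

lemma separation_left:
  assumes g: "sketch_guarantee V n dx dy m alg" and V: "{0, 1} \<subseteq> V" and m: "0 < m"
    and r: "2 * r \<le> m" "r \<le> n" "r \<le> dy"
    and S: "S \<subseteq> {..<r} \<times> {..<dx}" and T: "T \<subseteq> {..<r} \<times> {..<dx}"
    and eq: "alg (indicator_mat n dx S, indicator_mat n dy (Id_on {..<r}))
      = alg (indicator_mat n dx T, indicator_mat n dy (Id_on {..<r}))"
  shows "4 * real (card (S - T) + card (T - S)) \<le> (sqrt (card S) + sqrt (card T))\<^sup>2"
proof -
  obtain A B where AB: "alg (indicator_mat n dx S, indicator_mat n dy (Id_on {..<r})) = (A, B)"
    by fastforce
  let ?C = "transpose_mat A * B"
  note inp = indicator_mat_in_sketch_inputs[OF V]
  have C: "?C \<in> carrier_mat dx dy" by (rule sketch_guarantee_spectral_norm_le(1)[OF g m inp AB])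
  have fn: "frobenius_norm (indicator_mat n dx Z) = sqrt (card Z)"
    if "Z \<subseteq> {..<r} \<times> {..<dx}" for Z
    using that r by (intro frobenius_norm_indicator_mat) auto
  let ?e = "spectral_norm (indicator_mat dx dy (S\<inverse>) - ?C)"
  let ?f = "spectral_norm (indicator_mat dx dy (T\<inverse>) - ?C)"
  have e: "?e \<le> sqrt (card S) * sqrt (real r) / real m"
    using sketch_guarantee_spectral_norm_le(2)[OF g m inp AB] indicator_mat_mult_Id_on[OF r(2,3) S]
      fn[OF S] frobenius_norm_Id_on[OF r(2,3)] by simp
  \<comment> \<open>Rewriting with \<open>eq\<close> shows that \<open>(A, B)\<close> is also the
    output for \<open>T\<close>.\<close>
  have f: "?f \<le> sqrt (card T) * sqrt (real r) / real m"
    using sketch_guarantee_spectral_norm_le(2)[OF g m inp AB[unfolded eq]] indicator_mat_mult_Id_on[OF r(2,3) T]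
      fn[OF T] frobenius_norm_Id_on[OF r(2,3)] by simp
  have "real (card (S - T) + card (T - S))
      = (\<Sum>p\<in>{..<r} \<times> {..<dx}. (of_bool (p \<in> S) - of_bool (p \<in> T))\<^sup>2)"
    using S T by (intro card_symmetric_difference) auto
  also have "\<dots> = (\<Sum>b<r. \<Sum>a<dx. (indicator_mat dx dy (S\<inverse>) $$ (a, b) - indicator_mat dx dy (T\<inverse>) $$ (a, b))\<^sup>2)"
    unfolding sum.cartesian_product using r by (intro sum.cong) auto
  also have "\<dots> \<le> (\<Sum>b<r. (?e + ?f)\<^sup>2)"
    using r C by (intro sum_mono col_diff_le_spectral_norm[of _ _ dy]) auto
  finally have "real (card (S - T) + card (T - S)) \<le> real r * (?e + ?f)\<^sup>2" by simp
  then show ?thesis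
    by (rule separation_bound[OF _ r(1) m spectral_norm_nonneg e spectral_norm_nonneg f])
qed

text \<open>The mirror image: with the identity block in the first input, the cells appear
  untransposed in the first \<open>r\<close> rows of the product, so row errors replace column
  errors.\<close>

lemma separation_right:
  assumes g: "sketch_guarantee V n dx dy m alg" and V: "{0, 1} \<subseteq> V" and m: "0 < m"
    and r: "2 * r \<le> m" "r \<le> n" "r \<le> dx"
    and S: "S \<subseteq> {..<r} \<times> {..<dy}" and T: "T \<subseteq> {..<r} \<times> {..<dy}"
    and eq: "alg (indicator_mat n dx (Id_on {..<r}), indicator_mat n dy S)
      = alg (indicator_mat n dx (Id_on {..<r}), indicator_mat n dy T)"
  shows "4 * real (card (S - T) + card (T - S)) \<le> (sqrt (card S) + sqrt (card T))\<^sup>2"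
proof -
  obtain A B where AB: "alg (indicator_mat n dx (Id_on {..<r}), indicator_mat n dy S) = (A, B)"
    by fastforce
  let ?C = "transpose_mat A * B"
  note inp = indicator_mat_in_sketch_inputs[OF V]
  have C: "?C \<in> carrier_mat dx dy" by (rule sketch_guarantee_spectral_norm_le(1)[OF g m inp AB])
  have fn: "frobenius_norm (indicator_mat n dy Z) = sqrt (card Z)"
    if "Z \<subseteq> {..<r} \<times> {..<dy}" for Z
    using that r by (intro frobenius_norm_indicator_mat) auto
  let ?e = "spectral_norm (indicator_mat dx dy S - ?C)"
  let ?f = "spectral_norm (indicator_mat dx dy T - ?C)"
  have e: "?e \<le> sqrt (card S) * sqrt (real r) / real m"
    using sketch_guarantee_spectral_norm_le(2)[OF g m inp AB] Id_on_mult_indicator_mat[OF r(2,3) S]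
      fn[OF S] frobenius_norm_Id_on[OF r(2,3)] by (simp add: mult.commute)
  have f: "?f \<le> sqrt (card T) * sqrt (real r) / real m"
    using sketch_guarantee_spectral_norm_le(2)[OF g m inp AB[unfolded eq]] Id_on_mult_indicator_mat[OF r(2,3) T]
      fn[OF T] frobenius_norm_Id_on[OF r(2,3)] by (simp add: mult.commute)
  have "real (card (S - T) + card (T - S))
      = (\<Sum>p\<in>{..<r} \<times> {..<dy}. (of_bool (p \<in> S) - of_bool (p \<in> T))\<^sup>2)"
    using S T by (intro card_symmetric_difference) auto
  also have "\<dots> = (\<Sum>a<r. \<Sum>b<dy. (indicator_mat dx dy S $$ (a, b) - indicator_mat dx dy T $$ (a, b))\<^sup>2)"
    unfolding sum.cartesian_product using r by (intro sum.cong) auto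
  also have "\<dots> \<le> (\<Sum>a<r. (?e + ?f)\<^sup>2)"
    using r C by (intro sum_mono row_diff_le_spectral_norm[of _ dx]) auto
  finally have "real (card (S - T) + card (T - S)) \<le> real r * (?e + ?f)\<^sup>2" by simp
  then show ?thesis
    by (rule separation_bound[OF _ r(1) m spectral_norm_nonneg e spectral_norm_nonneg f])
qed

section \<open>The space bound\<close>

lemma memory_lower_bound:
  assumes mem: "works_in_memory w s I alg" and R: "finite R" "R \<noteq> {}"
    and inp: "\<And>S. inp S \<in> I"
    and sep: "\<And>S T. S \<subseteq> R \<Longrightarrow> T \<subseteq> R \<Longrightarrow> alg (inp S) = alg (inp T) \<Longrightarrow>
      4 * real (card (S - T) + card (T - S)) \<le> (sqrt (card S) + sqrt (card T))\<^sup>2"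
  shows "card R \<le> 32 * (w * s)"
proof -
  obtain process decode where pd: "\<And>p. p \<in> I \<Longrightarrow> process p \<in> memory_states w s"
      "\<And>p. p \<in> I \<Longrightarrow> alg p = decode (process p)"
    using mem unfolding works_in_memory_def by blast
  \<comment> \<open>Equal memory contents decode to equal outputs, so \<open>sep\<close> applies to
    the map from cell sets to contents.\<close>
  show ?thesis
    by (rule card_le_of_separating[OF R finite_memory_states card_memory_states, where f = "process \<circ> inp"])
      (use pd inp sep in auto)
qed

theorem theorem2:
  shows "\<exists>c>(0::real). \<forall>(n::nat) (dx::nat) (dy::nat) (m::nat) (w::nat) (s::nat)
           (V::real set) (alg::sketching_algorithm).
     2 \<le> m \<longrightarrow> m < n \<longrightarrow> m < dx \<longrightarrow> m < dy \<longrightarrow> {0, 1} \<subseteq> V \<longrightarrow>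
     sketch_guarantee V n dx dy m alg \<longrightarrow>
     works_in_memory w s (sketch_inputs V n dx dy) alg \<longrightarrow>
     c * (real m * (real dx + real dy)) \<le> real (w * s)"
proof (intro exI[of _ "1 / 192"] conjI allI impI)
  fix n dx dy m w s :: nat and V :: "real set" and alg :: sketching_algorithm
  assume m: "2 \<le> m" "m < n" "m < dx" "m < dy" and V: "{0, 1} \<subseteq> V"
    and g: "sketch_guarantee V n dx dy m alg"
    and mem: "works_in_memory w s (sketch_inputs V n dx dy) alg"
  define r where "r = m div 2"
  \<comment> \<open>\<open>m \<le> 3 * r\<close> relies on \<open>2 \<le> m\<close>; equality occurs
    at \<open>m = 3\<close>.\<close>
  have r: "0 < r" "2 * r \<le> m" "r \<le> n" "r \<le> dx" "r \<le> dy" "m \<le> 3 * r"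
    using m unfolding r_def by auto
  have "card ({..<r} \<times> {..<dx}) \<le> 32 * (w * s)"
  proof (rule memory_lower_bound[OF mem])
    show "{..<r} \<times> {..<dx} \<noteq> {}" using r m by (auto simp: lessThan_empty_iff)
    show "(indicator_mat n dx S, indicator_mat n dy (Id_on {..<r})) \<in> sketch_inputs V n dx dy" for S
      by (rule indicator_mat_in_sketch_inputs[OF V])
    show "4 * real (card (S - T) + card (T - S)) \<le> (sqrt (card S) + sqrt (card T))\<^sup>2"
      if "S \<subseteq> {..<r} \<times> {..<dx}" "T \<subseteq> {..<r} \<times> {..<dx}"
        "alg (indicator_mat n dx S, indicator_mat n dy (Id_on {..<r})) = alg (indicator_mat n dx T, indicator_mat n dy (Id_on {..<r}))" for S T
      by (rule separation_left[OF g V _ r(2,3) r(5) that]) (use m in simp)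
  qed simp
  moreover have "card ({..<r} \<times> {..<dy}) \<le> 32 * (w * s)"
  proof (rule memory_lower_bound[OF mem])
    show "{..<r} \<times> {..<dy} \<noteq> {}" using r m by (auto simp: lessThan_empty_iff)
    show "(indicator_mat n dx (Id_on {..<r}), indicator_mat n dy S) \<in> sketch_inputs V n dx dy" for S
      by (rule indicator_mat_in_sketch_inputs[OF V])
    show "4 * real (card (S - T) + card (T - S)) \<le> (sqrt (card S) + sqrt (card T))\<^sup>2"
      if "S \<subseteq> {..<r} \<times> {..<dy}" "T \<subseteq> {..<r} \<times> {..<dy}"
        "alg (indicator_mat n dx (Id_on {..<r}), indicator_mat n dy S) = alg (indicator_mat n dx (Id_on {..<r}), indicator_mat n dy T)" for S T
      by (rule separation_right[OF g V _ r(2,3) r(4) that]) (use m in simp)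
  qed simp
  \<comment> \<open>Adding the two bounds doubles 32 to 64, and \<open>m \<le> 3 * r\<close> then
    gives the constant 192.\<close>
  ultimately have "r * (dx + dy) \<le> 64 * (w * s)" by (simp add: distrib_left)
  moreover have "m * (dx + dy) \<le> 3 * r * (dx + dy)" using r by (intro mult_right_mono) auto
  ultimately have "m * (dx + dy) \<le> 192 * (w * s)" by linarith
  then have "real (m * (dx + dy)) \<le> real (192 * (w * s))" by (rule of_nat_mono)
  then show "1 / 192 * (real m * (real dx + real dy)) \<le> real (w * s)" by simp
qed simp

end
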